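(* Let $G$ be a finite group and let $\mathscr L$ be a finite $G$-lattice. For each subgroup $H\leq G$, let $\mathscr L_H$ be a nonempty sublattice of $\mathscr L$. Suppose that the family $(\mathscr L_H)_{H\leq G}$ satisfies the following conditions for all $H\le G$: (1) $\mathscr L_{{}^gH}=\{{}^gs \mid s\in\mathscr L_H\}$ for any $g\in G$; (2) ${}^hs=s$ for any $h\in H$ and $s\in\mathscr L_H$; (3) $s\wedge\sup\mathscr L_K\in\mathscr L_K$ for any $K\leq H$ and $s\in\mathscr L_H$; (4) $\sup\mathscr L_K\leq\sup\mathscr L_H$ for any $K\leq H$. Then there exists a monoid functor $M_{\mathscr L}=(M_{\mathscr L},\mathrm{con},\mathrm{res})$ for $G$ given by $$M_{\mathscr L}(H)=\mathscr L_H,\qquad \mathrm{con}_H^g:\mathscr L_H\to\mathscr L_{{}^gH},\ s\mapsto{}^gs,\qquad \mathrm{res}_K^H:\mathscr L_H\to\mathscr L_K,\ s\mapsto s\wedge\sup\mathscr L_K$$ for all $g\in G$ and $K\leq H\leq G$.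
   Context: Write ${}^gH=gHg^{-1}$. A finite $G$-lattice is a finite lattice $(\mathscr L,\leq)$ with a left $G$-action $(g,s)\mapsto{}^gs$ such that the relation $\leq$ is invariant under the action of $G$. $\wedge$ denotes the meet, and $\sup$ the least upper bound in $\mathscr L$. A nonempty sublattice $\mathscr L_H$ (closed under meet and join) is regarded as a monoid with operation $s\cdot t=s\wedge t$, whose identity is its greatest element $\sup\mathscr L_H$. A monoid functor for $G$ is a triple $M=(M,\mathrm{con},\mathrm{res})$ consisting of a family of monoids $M(H)$, $H\leq G$, and monoid homomorphisms (preserving identity elements) $\mathrm{con}_H^g:M(H)\to M({}^gH)$ and $\mathrm{res}_K^H:M(H)\to M(K)$ for $g\in G$, $K\leq H\leq G$, satisfying, for all $L\leq K\leq H\leq G$, $g,r\in G$, $h\in H$: (M.1) $\mathrm{con}_{{}^rH}^g\circ\mathrm{con}_H^r=\mathrm{con}_H^{gr}$ and $\mathrm{con}_H^h=\mathrm{id}_{M(H)}$; (M.2) $\mathrm{res}_L^K\circ\mathrm{res}_K^H=\mathrm{res}_L^H$ and $\mathrm{res}_H^H=\mathrm{id}_{M(H)}$; (M.3) $\mathrm{con}_K^g\circ\mathrm{res}_K^H=\mathrm{res}_{{}^gK}^{{}^gH}\circ\mathrm{con}_H^g$. *)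

theory Defs
  imports "HOL-Algebra.Algebra"
begin

definition conjugate :: "('a, 'm) monoid_scheme \<Rightarrow> 'a \<Rightarrow> 'a set \<Rightarrow> 'a set" where
  "conjugate G g H = g <#\<^bsub>G\<^esub> H #>\<^bsub>G\<^esub> (inv\<^bsub>G\<^esub> g)"

definition monoid_hom ::
    "('a, 'm) monoid_scheme \<Rightarrow> ('b, 'n) monoid_scheme \<Rightarrow> ('a \<Rightarrow> 'b) set" where
  "monoid_hom A B = {f \<in> hom A B. f \<one>\<^bsub>A\<^esub> = \<one>\<^bsub>B\<^esub>}"

text \<open>
  \<open>con g H\<close> stands for $\mathrm{con}_H^g$ and \<open>res H K\<close> for $\mathrm{res}_K^H$. As usual in
  HOL-Algebra, equality of maps out of \<open>M H\<close> means equality on \<open>carrier (M H)\<close>.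
  A subgroup $K$ of $H \le G$ is given as a subgroup $K$ of $G$ with $K \subseteq H$.
\<close>

locale monoid_functor = group G for G (structure) +
  fixes M :: "'a set \<Rightarrow> ('c, 'n) monoid_scheme"
    and con :: "'a \<Rightarrow> 'a set \<Rightarrow> 'c \<Rightarrow> 'c"
    and res :: "'a set \<Rightarrow> 'a set \<Rightarrow> 'c \<Rightarrow> 'c"
  assumes monoid_M: "subgroup H G \<Longrightarrow> monoid (M H)"
    and con_hom: "\<lbrakk>subgroup H G; g \<in> carrier G\<rbrakk>
      \<Longrightarrow> con g H \<in> monoid_hom (M H) (M (conjugate G g H))"
    and res_hom: "\<lbrakk>subgroup H G; subgroup K G; K \<subseteq> H\<rbrakk>
      \<Longrightarrow> res H K \<in> monoid_hom (M H) (M K)"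
    and con_con: "\<lbrakk>subgroup H G; g \<in> carrier G; r \<in> carrier G; x \<in> carrier (M H)\<rbrakk>
      \<Longrightarrow> con g (conjugate G r H) (con r H x) = con (g \<otimes> r) H x"
    and con_id: "\<lbrakk>subgroup H G; h \<in> H; x \<in> carrier (M H)\<rbrakk> \<Longrightarrow> con h H x = x"
    and res_res: "\<lbrakk>subgroup H G; subgroup K G; subgroup J G; J \<subseteq> K; K \<subseteq> H;
        x \<in> carrier (M H)\<rbrakk>
      \<Longrightarrow> res K J (res H K x) = res H J x"
    and res_id: "\<lbrakk>subgroup H G; x \<in> carrier (M H)\<rbrakk> \<Longrightarrow> res H H x = x"
    and con_res: "\<lbrakk>subgroup H G; subgroup K G; K \<subseteq> H; g \<in> carrier G; x \<in> carrier (M H)\<rbrakk>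
      \<Longrightarrow> con g K (res H K x) = res (conjugate G g H) (conjugate G g K) (con g H x)"

text \<open>
  A \<open>group_action\<close> is a homomorphism into \<open>BijGroup E\<close>, whose product is composition, i.e. a left
  action. The locale \<open>lattice\<close> has genuine equality as its equivalence relation.
\<close>

locale finite_G_lattice =
    lat: lattice L + act: group_action G "carrier L" \<phi>
  for G :: "('a, 'm) monoid_scheme" and L :: "('b, 'n) gorder_scheme"
    and \<phi> :: "'a \<Rightarrow> 'b \<Rightarrow> 'b" +
  assumes finite_carrier: "finite (carrier L)"
    and le_invariant: "\<lbrakk>g \<in> carrier G; s \<in> carrier L; t \<in> carrier L; s \<sqsubseteq>\<^bsub>L\<^esub> t\<rbrakk>
      \<Longrightarrow> \<phi> g s \<sqsubseteq>\<^bsub>L\<^esub> \<phi> g t"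

definition sublattice :: "('b, 'n) gorder_scheme \<Rightarrow> 'b set \<Rightarrow> bool" where
  "sublattice L S \<longleftrightarrow> S \<subseteq> carrier L \<and>
     (\<forall>s\<in>S. \<forall>t\<in>S. s \<sqinter>\<^bsub>L\<^esub> t \<in> S \<and> s \<squnion>\<^bsub>L\<^esub> t \<in> S)"

definition meet_monoid :: "('b, 'n) gorder_scheme \<Rightarrow> 'b set \<Rightarrow> 'b monoid" where
  "meet_monoid L S = \<lparr>carrier = S, monoid.mult = (\<lambda>s t. s \<sqinter>\<^bsub>L\<^esub> t), one = \<Squnion>\<^bsub>L\<^esub>S\<rparr>"

end

theory Submission
  imports Defs
begin

text \<open>
  Two observations reduce the theorem to elementary lattice identities. A nonempty finite
  sublattice contains its own supremum, so meeting with that supremum is the identity on the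
  sublattice, and the sublattice is a monoid under meet with the supremum as unit. And each
  group element acts on the lattice as an order automorphism, because its inverse acts
  monotonically too; it therefore commutes with meets and with suprema (\<open>act_meet\<close>, \<open>act_sup\<close>).
  This makes conjugation a monoid homomorphism, and it reduces the compatibility of conjugation with
  restriction to
  \[ {}^g(s \wedge \sup \mathscr{L}_K) = {}^gs \wedge \sup {}^g\mathscr{L}_K
     = {}^gs \wedge \sup \mathscr{L}_{{}^gK}. \]

  Restriction is meeting with a fixed element, hence multiplicative by idempotence of the meet.
  By assumption the elements $\sup\mathscr{L}_K$ grow with $K$. For $K \le H$ this gives
  $\sup\mathscr{L}_H \wedge \sup\mathscr{L}_K = \sup\mathscr{L}_K$, so that restriction
  preserves units, and the same absorption makes successive restrictions compose.
\<close>

section \<open>Meets and suprema in finite sublattices\<close>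

context lattice
begin

lemma meet_absorb_left:
  assumes "x \<in> carrier L" "y \<in> carrier L" "x \<sqsubseteq> y"
  shows "x \<sqinter> y = x"
  using assms by (meson le_antisym le_refl meet_closed meet_le meet_left)

lemma meet_absorb_right:
  assumes "x \<in> carrier L" "y \<in> carrier L" "x \<sqsubseteq> y"
  shows "y \<sqinter> x = x"
  using meet_absorb_left[OF assms] meet_comm[of L y x] by simp

lemma meet_assoc:
  assumes "x \<in> carrier L" "y \<in> carrier L" "z \<in> carrier L"
  shows "(x \<sqinter> y) \<sqinter> z = x \<sqinter> (y \<sqinter> z)"
  using weak_meet_assoc[OF assms] by (simp add: eq_is_equal)

lemma meet_meet_distrib:
  assumes "x \<in> carrier L" "y \<in> carrier L" "z \<in> carrier L"
  shows "(x \<sqinter> y) \<sqinter> z = (x \<sqinter> z) \<sqinter> (y \<sqinter> z)"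
proof (rule le_antisym)
  have xyz: "(x \<sqinter> y) \<sqinter> z \<sqsubseteq> x \<sqinter> y" "(x \<sqinter> y) \<sqinter> z \<sqsubseteq> z"
    using assms by (simp_all add: meet_left meet_right)
  have "(x \<sqinter> y) \<sqinter> z \<sqsubseteq> x" "(x \<sqinter> y) \<sqinter> z \<sqsubseteq> y"
    using assms xyz(1) by (meson le_trans meet_closed meet_left meet_right)+
  then show "(x \<sqinter> y) \<sqinter> z \<sqsubseteq> (x \<sqinter> z) \<sqinter> (y \<sqinter> z)"
    using assms xyz(2) by (simp add: meet_le)
  let ?m = "(x \<sqinter> z) \<sqinter> (y \<sqinter> z)"
  have m: "?m \<sqsubseteq> x \<sqinter> z" "?m \<sqsubseteq> y \<sqinter> z"
    using assms by (simp_all add: meet_left meet_right)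
  have "?m \<sqsubseteq> x" "?m \<sqsubseteq> y" "?m \<sqsubseteq> z"
    using assms m by (meson le_trans meet_closed meet_left meet_right)+
  then show "?m \<sqsubseteq> (x \<sqinter> y) \<sqinter> z"
    using assms by (simp add: meet_le)
qed (use assms in simp_all)

lemma finite_sup_upper:
  assumes "finite A" "A \<subseteq> carrier L" "x \<in> A"
  shows "x \<sqsubseteq> \<Squnion>A"
proof -
  have "least L (\<Squnion>A) (Upper L A)"
    using assms by (intro finite_sup_least) auto
  then show ?thesis
    using assms by (blast intro: least_Upper_above)
qed

lemma sup_eq_greatest:
  assumes "A \<subseteq> carrier L" "m \<in> A" "\<And>x. x \<in> A \<Longrightarrow> x \<sqsubseteq> m"
  shows "\<Squnion>A = m"
proof -
  have "least L m (Upper L A)"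
    using assms by (intro least_UpperI) (auto simp: Upper_def)
  then show ?thesis
    unfolding sup_def by (metis least_unique someI)
qed

text \<open>
  Joining the elements of \<open>A\<close> one at a time never leaves \<open>S\<close>. For finite \<open>S\<close> the choice \<open>A = S\<close>
  yields a greatest element of \<open>S\<close>, which is then its supremum. The separate set \<open>A\<close> is there for
  the induction, since a subset of a sublattice need not be a sublattice.
\<close>

lemma sublattice_finite_bound:
  assumes "sublattice L S" "finite A" "A \<noteq> {}" "A \<subseteq> S"
  shows "\<exists>m\<in>S. \<forall>x\<in>A. x \<sqsubseteq> m"
  using assms(2-4)
proof (induction A rule: finite_ne_induct)
  case (singleton x)
  then show ?case
    using assms(1) by (auto simp: sublattice_def)
next
  case (insert x A)
  then obtain m where m: "m \<in> S" "\<And>y. y \<in> A \<Longrightarrow> y \<sqsubseteq> m"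
    by auto
  have carr: "x \<in> carrier L" "m \<in> carrier L" "A \<subseteq> carrier L"
    using insert.prems m(1) assms(1) by (auto simp: sublattice_def)
  have "y \<sqsubseteq> x \<squnion> m" if "y \<in> A" for y
    using that m(2) carr by (meson join_closed join_right le_trans subsetD)
  moreover have "x \<squnion> m \<in> S"
    using insert.prems m(1) assms(1) by (auto simp: sublattice_def)
  ultimately show ?case
    using carr join_left by (intro bexI[of _ "x \<squnion> m"]) auto
qed

lemma sublattice_sup_mem:
  assumes "sublattice L S" "finite S" "S \<noteq> {}"
  shows "\<Squnion>S \<in> S"
proof -
  obtain m where "m \<in> S" "\<And>x. x \<in> S \<Longrightarrow> x \<sqsubseteq> m"
    using sublattice_finite_bound[OF assms subset_refl] by blast
  moreover have "S \<subseteq> carrier L"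
    using assms(1) by (simp add: sublattice_def)
  ultimately show ?thesis
    using sup_eq_greatest by simp
qed

lemma monoid_meet_monoid:
  assumes "sublattice L S" "finite S" "S \<noteq> {}"
  shows "monoid (meet_monoid L S)"
proof -
  have S: "S \<subseteq> carrier L" "\<And>s t. s \<in> S \<Longrightarrow> t \<in> S \<Longrightarrow> s \<sqinter> t \<in> S"
    using assms(1) by (auto simp: sublattice_def)
  have top: "\<Squnion>S \<in> S"
    by (rule sublattice_sup_mem[OF assms])
  show ?thesis
  proof (rule monoidI)
    fix x y z assume "x \<in> carrier (meet_monoid L S)" "y \<in> carrier (meet_monoid L S)"
      "z \<in> carrier (meet_monoid L S)"
    then show "x \<otimes>\<^bsub>meet_monoid L S\<^esub> y \<otimes>\<^bsub>meet_monoid L S\<^esub> z =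
        x \<otimes>\<^bsub>meet_monoid L S\<^esub> (y \<otimes>\<^bsub>meet_monoid L S\<^esub> z)"
      using S(1) by (auto simp: meet_monoid_def intro!: meet_assoc)
  next
    fix x assume "x \<in> carrier (meet_monoid L S)"
    then have x: "x \<in> S" "x \<in> carrier L" "x \<sqsubseteq> \<Squnion>S"
      using S(1) finite_sup_upper[OF assms(2) S(1)] by (auto simp: meet_monoid_def)
    have "\<Squnion>S \<in> carrier L"
      using top S(1) by blast
    then show "\<one>\<^bsub>meet_monoid L S\<^esub> \<otimes>\<^bsub>meet_monoid L S\<^esub> x = x"
      and "x \<otimes>\<^bsub>meet_monoid L S\<^esub> \<one>\<^bsub>meet_monoid L S\<^esub> = x"
      using x meet_absorb_left meet_absorb_right by (simp_all add: meet_monoid_def)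
  qed (use S top in \<open>auto simp: meet_monoid_def\<close>)
qed

end

section \<open>Group elements as lattice automorphisms\<close>

context finite_G_lattice
begin

lemma act_closed:
  assumes "g \<in> carrier G" "s \<in> carrier L"
  shows "\<phi> g s \<in> carrier L"
  using act.element_image[OF assms refl] .

lemma act_inv_cancel:
  assumes "g \<in> carrier G" "s \<in> carrier L"
  shows "\<phi> (inv\<^bsub>G\<^esub> g) (\<phi> g s) = s" and "\<phi> g (\<phi> (inv\<^bsub>G\<^esub> g) s) = s"
proof -
  interpret group G
    using act.group_hom group_hom.axioms(1) by auto
  show "\<phi> (inv\<^bsub>G\<^esub> g) (\<phi> g s) = s"
    by (rule act.orbit_sym_aux[OF assms refl])
  show "\<phi> g (\<phi> (inv\<^bsub>G\<^esub> g) s) = s"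
    using act.orbit_sym_aux[of "inv\<^bsub>G\<^esub> g", OF _ assms(2) refl] assms(1) by simp
qed

text \<open>
  Monotonicity of \<open>\<phi> g\<close> gives one inequality. The converse is obtained by pulling the right-hand side back along the action of the inverse of \<open>g\<close>,
  which is monotone too and so lands below both \<open>s\<close> and \<open>t\<close>.
\<close>

lemma act_meet:
  assumes g: "g \<in> carrier G" and s: "s \<in> carrier L" and t: "t \<in> carrier L"
  shows "\<phi> g (s \<sqinter>\<^bsub>L\<^esub> t) = \<phi> g s \<sqinter>\<^bsub>L\<^esub> \<phi> g t"
proof (rule lat.le_antisym)
  interpret group G
    using act.group_hom group_hom.axioms(1) by auto
  have gi: "inv\<^bsub>G\<^esub> g \<in> carrier G"
    using g by simp
  let ?m = "\<phi> g s \<sqinter>\<^bsub>L\<^esub> \<phi> g t"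
  have m: "?m \<in> carrier L"
    using assms act_closed by simp
  show "\<phi> g (s \<sqinter>\<^bsub>L\<^esub> t) \<sqsubseteq>\<^bsub>L\<^esub> ?m"
    using assms act_closed
    by (intro lat.meet_le le_invariant lat.meet_left lat.meet_right) auto
  have "\<phi> (inv\<^bsub>G\<^esub> g) ?m \<sqsubseteq>\<^bsub>L\<^esub> \<phi> (inv\<^bsub>G\<^esub> g) (\<phi> g s)"
    "\<phi> (inv\<^bsub>G\<^esub> g) ?m \<sqsubseteq>\<^bsub>L\<^esub> \<phi> (inv\<^bsub>G\<^esub> g) (\<phi> g t)"
    using assms gi m act_closed
    by (auto intro!: le_invariant lat.meet_left lat.meet_right)
  then have "\<phi> (inv\<^bsub>G\<^esub> g) ?m \<sqsubseteq>\<^bsub>L\<^esub> s \<sqinter>\<^bsub>L\<^esub> t"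
    using assms gi m act_closed act_inv_cancel(1) by (simp add: lat.meet_le)
  then have "\<phi> g (\<phi> (inv\<^bsub>G\<^esub> g) ?m) \<sqsubseteq>\<^bsub>L\<^esub> \<phi> g (s \<sqinter>\<^bsub>L\<^esub> t)"
    using assms gi m act_closed by (intro le_invariant) auto
  then show "?m \<sqsubseteq>\<^bsub>L\<^esub> \<phi> g (s \<sqinter>\<^bsub>L\<^esub> t)"
    using act_inv_cancel(2)[OF g m] by simp
qed (use assms act_closed in simp_all)

lemma finite_sublattice:
  assumes "sublattice L S"
  shows "finite S"
  using assms finite_carrier by (auto simp: sublattice_def intro: finite_subset)

text \<open>
  Since the supremum belongs to the sublattice, its image is the greatest element of the image,
  and monotonicity of the action suffices.
\<close>

lemma act_sup:
  assumes g: "g \<in> carrier G" and S: "sublattice L S" "S \<noteq> {}"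
  shows "\<Squnion>\<^bsub>L\<^esub>(\<phi> g ` S) = \<phi> g (\<Squnion>\<^bsub>L\<^esub>S)"
proof (rule lat.sup_eq_greatest)
  have sub: "S \<subseteq> carrier L"
    using S(1) by (simp add: sublattice_def)
  have top: "\<Squnion>\<^bsub>L\<^esub>S \<in> S"
    by (rule lat.sublattice_sup_mem[OF S(1) finite_sublattice[OF S(1)] S(2)])
  show "\<phi> g ` S \<subseteq> carrier L"
    using sub act_closed[OF g] by auto
  show "\<phi> g (\<Squnion>\<^bsub>L\<^esub>S) \<in> \<phi> g ` S"
    using top by simp
  fix x assume "x \<in> \<phi> g ` S"
  then obtain s where "s \<in> S" "x = \<phi> g s"
    by auto
  then show "x \<sqsubseteq>\<^bsub>L\<^esub> \<phi> g (\<Squnion>\<^bsub>L\<^esub>S)"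
    using sub top le_invariant[OF g] lat.finite_sup_upper[OF finite_sublattice[OF S(1)] sub]
    by (meson subsetD)
qed

lemma act_monoid_hom:
  assumes g: "g \<in> carrier G" and S: "sublattice L S" "S \<noteq> {}"
  shows "(\<lambda>s\<in>S. \<phi> g s) \<in> monoid_hom (meet_monoid L S) (meet_monoid L (\<phi> g ` S))"
proof -
  have sub: "S \<subseteq> carrier L" and meet: "\<And>s t. s \<in> S \<Longrightarrow> t \<in> S \<Longrightarrow> s \<sqinter>\<^bsub>L\<^esub> t \<in> S"
    using S(1) by (auto simp: sublattice_def)
  have "\<Squnion>\<^bsub>L\<^esub>S \<in> S"
    by (rule lat.sublattice_sup_mem[OF S(1) finite_sublattice[OF S(1)] S(2)])
  moreover have "\<phi> g (s \<sqinter>\<^bsub>L\<^esub> t) = \<phi> g s \<sqinter>\<^bsub>L\<^esub> \<phi> g t" if "s \<in> S" "t \<in> S" for s t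
    using that sub act_meet[OF g] by blast
  ultimately show ?thesis
    using meet act_sup[OF g S] by (auto simp: monoid_hom_def hom_def meet_monoid_def)
qed

lemma meet_sup_monoid_hom:
  assumes S: "sublattice L S" "S \<noteq> {}" and T: "sublattice L T" "T \<noteq> {}"
    and mem: "\<And>s. s \<in> S \<Longrightarrow> s \<sqinter>\<^bsub>L\<^esub> \<Squnion>\<^bsub>L\<^esub>T \<in> T"
    and le: "\<Squnion>\<^bsub>L\<^esub>T \<sqsubseteq>\<^bsub>L\<^esub> \<Squnion>\<^bsub>L\<^esub>S"
  shows "(\<lambda>s\<in>S. s \<sqinter>\<^bsub>L\<^esub> \<Squnion>\<^bsub>L\<^esub>T) \<in> monoid_hom (meet_monoid L S) (meet_monoid L T)"
proof -
  have sub: "S \<subseteq> carrier L" "T \<subseteq> carrier L"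
    and meet: "\<And>s t. s \<in> S \<Longrightarrow> t \<in> S \<Longrightarrow> s \<sqinter>\<^bsub>L\<^esub> t \<in> S"
    using S(1) T(1) by (auto simp: sublattice_def)
  have top: "\<Squnion>\<^bsub>L\<^esub>S \<in> S" "\<Squnion>\<^bsub>L\<^esub>T \<in> T"
    using S T by (auto intro!: lat.sublattice_sup_mem finite_sublattice)
  have carr: "\<Squnion>\<^bsub>L\<^esub>S \<in> carrier L" "\<Squnion>\<^bsub>L\<^esub>T \<in> carrier L"
    using top sub by blast+
  have "(s \<sqinter>\<^bsub>L\<^esub> t) \<sqinter>\<^bsub>L\<^esub> \<Squnion>\<^bsub>L\<^esub>T = (s \<sqinter>\<^bsub>L\<^esub> \<Squnion>\<^bsub>L\<^esub>T) \<sqinter>\<^bsub>L\<^esub> (t \<sqinter>\<^bsub>L\<^esub> \<Squnion>\<^bsub>L\<^esub>T)"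
    if "s \<in> S" "t \<in> S" for s t
    using that sub(1) carr(2) lat.meet_meet_distrib by blast
  then show ?thesis
    using mem meet top(1) lat.meet_absorb_right[OF carr(2,1) le]
    by (auto simp: monoid_hom_def hom_def meet_monoid_def)
qed

end

section \<open>The functor of fixed sublattices\<close>

theorem proposition4p2:
  fixes G :: "('a, 'm) monoid_scheme"
    and L :: "('b, 'n) gorder_scheme"
    and \<phi> :: "'a \<Rightarrow> 'b \<Rightarrow> 'b"
    and S :: "'a set \<Rightarrow> 'b set"
  assumes "group G" and "finite (carrier G)"
    and "finite_G_lattice G L \<phi>"
    and "\<And>H. subgroup H G \<Longrightarrow> sublattice L (S H) \<and> S H \<noteq> {}"
    and "\<And>H g. \<lbrakk>subgroup H G; g \<in> carrier G\<rbrakk>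
      \<Longrightarrow> S (conjugate G g H) = {\<phi> g s | s. s \<in> S H}"
    and "\<And>H h s. \<lbrakk>subgroup H G; h \<in> H; s \<in> S H\<rbrakk> \<Longrightarrow> \<phi> h s = s"
    and "\<And>H K s. \<lbrakk>subgroup H G; subgroup K G; K \<subseteq> H; s \<in> S H\<rbrakk>
      \<Longrightarrow> s \<sqinter>\<^bsub>L\<^esub> (\<Squnion>\<^bsub>L\<^esub>(S K)) \<in> S K"
    and "\<And>H K. \<lbrakk>subgroup H G; subgroup K G; K \<subseteq> H\<rbrakk>
      \<Longrightarrow> \<Squnion>\<^bsub>L\<^esub>(S K) \<sqsubseteq>\<^bsub>L\<^esub> \<Squnion>\<^bsub>L\<^esub>(S H)"
  shows "monoid_functor G
    (\<lambda>H. meet_monoid L (S H))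
    (\<lambda>g H. \<lambda>s \<in> S H. \<phi> g s)
    (\<lambda>H K. \<lambda>s \<in> S H. s \<sqinter>\<^bsub>L\<^esub> (\<Squnion>\<^bsub>L\<^esub>(S K)))"
proof -
  interpret finite_G_lattice G L \<phi>
    by (rule assms(3))
  interpret group G
    by (rule assms(1))
  note fixed = assms(6) and restr_mem = assms(7) and sup_mono = assms(8)
  have sub: "sublattice L (S H)" and ne: "S H \<noteq> {}" if "subgroup H G" for H
    using assms(4)[OF that] by auto
  have S_conj: "S (conjugate G g H) = \<phi> g ` S H" if "subgroup H G" "g \<in> carrier G" for g H
    using assms(5)[OF that] by auto
  have carr: "s \<in> carrier L" if "subgroup H G" "s \<in> S H" for H s
    using sub[OF that(1)] that(2) by (auto simp: sublattice_def)
  have fin: "finite (S H)" if "subgroup H G" for H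
    by (rule finite_sublattice[OF sub[OF that]])
  have sup_carr: "\<Squnion>\<^bsub>L\<^esub>(S H) \<in> carrier L" if "subgroup H G" for H
    by (rule carr[OF that lat.sublattice_sup_mem[OF sub[OF that] fin[OF that] ne[OF that]]])
  have sup_upper: "s \<sqsubseteq>\<^bsub>L\<^esub> \<Squnion>\<^bsub>L\<^esub>(S H)" if "subgroup H G" "s \<in> S H" for H s
    using lat.finite_sup_upper[OF fin[OF that(1)]] carr[OF that(1)] that(2) by blast
  show ?thesis
  proof (intro monoid_functor.intro[OF assms(1)] monoid_functor_axioms.intro, goal_cases)
    case (1 H)
    then show ?case
      by (intro lat.monoid_meet_monoid sub fin ne)
  next
    case (2 H g)
    then show ?case
      using act_monoid_hom[OF 2(2) sub[OF 2(1)] ne[OF 2(1)]] by (simp add: S_conj)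
  next
    case (3 H K)
    then show ?case
      by (intro meet_sup_monoid_hom sub ne sup_mono restr_mem[of H K])
  next
    case (4 H g r x)
    then have "x \<in> S H"
      by (simp add: meet_monoid_def)
    then show ?case
      using 4 act.composition_rule[OF carr[of H x] 4(2,3)] by (simp add: S_conj)
  next
    case (5 H h x)
    then show ?case
      using fixed by (simp add: meet_monoid_def)
  next
    case (6 H K J x)
    then have x: "x \<in> S H"
      by (simp add: meet_monoid_def)
    have "(x \<sqinter>\<^bsub>L\<^esub> \<Squnion>\<^bsub>L\<^esub>(S K)) \<sqinter>\<^bsub>L\<^esub> \<Squnion>\<^bsub>L\<^esub>(S J) = x \<sqinter>\<^bsub>L\<^esub> (\<Squnion>\<^bsub>L\<^esub>(S K) \<sqinter>\<^bsub>L\<^esub> \<Squnion>\<^bsub>L\<^esub>(S J))"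
      using 6 carr x sup_carr by (blast intro: lat.meet_assoc)
    also have "\<Squnion>\<^bsub>L\<^esub>(S K) \<sqinter>\<^bsub>L\<^esub> \<Squnion>\<^bsub>L\<^esub>(S J) = \<Squnion>\<^bsub>L\<^esub>(S J)"
      using 6 by (intro lat.meet_absorb_right sup_carr sup_mono)
    finally show ?case
      using x restr_mem[OF 6(1,2,5) x] by simp
  next
    case (7 H x)
    then have x: "x \<in> S H"
      by (simp add: meet_monoid_def)
    then show ?case
      using lat.meet_absorb_left[OF carr sup_carr sup_upper] 7(1) by simp
  next
    case (8 H K g x)
    then have x: "x \<in> S H"
      by (simp add: meet_monoid_def)
    have "\<phi> g (x \<sqinter>\<^bsub>L\<^esub> \<Squnion>\<^bsub>L\<^esub>(S K)) = \<phi> g x \<sqinter>\<^bsub>L\<^esub> \<phi> g (\<Squnion>\<^bsub>L\<^esub>(S K))"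
      by (rule act_meet[OF 8(4) carr[OF 8(1) x] sup_carr[OF 8(2)]])
    also have "\<phi> g (\<Squnion>\<^bsub>L\<^esub>(S K)) = \<Squnion>\<^bsub>L\<^esub>(S (conjugate G g K))"
      using act_sup[OF 8(4) sub[OF 8(2)] ne[OF 8(2)]] by (simp add: S_conj 8)
    finally show ?case
      using x restr_mem[OF 8(1-3) x] by (simp add: S_conj 8)
  qed
qed

end
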